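(* Let $\mathbb{X}$ be a two-dimensional real polyhedral Banach space such that $S_{\mathbb{X}}$ is a regular polygon with $4n$ sides, where $n \in \mathbb{N}$, $n \geq 1$. Then $x \in S_{\mathbb{X}}$ is a right-symmetric point in $\mathbb{X}$ if and only if $x$ is an extreme point of $B_{\mathbb{X}}$.
   Context: For a real Banach space $\mathbb{X}$, $B_{\mathbb{X}} = \{x \in \mathbb{X} : \|x\| \leq 1\}$ and $S_{\mathbb{X}} = \{x \in \mathbb{X} : \|x\| = 1\}$; $\mathbb{X}$ is polyhedral if $B_{\mathbb{X}}$ has only finitely many extreme points. Up to an isomorphism, saying that $S_{\mathbb{X}}$ is a regular polygon with $4n$ sides means that $\mathbb{X} = \mathbb{R}^2$ with the norm whose unit ball $B_{\mathbb{X}}$ is the convex hull of the vertices $v_j = (\cos\frac{2\pi j}{4n}, \sin\frac{2\pi j}{4n})$, $j = 0, 1, \dots, 4n-1$. For $x,y \in \mathbb{X}$, $x$ is Birkhoff-James orthogonal to $y$, written $x \perp_B y$, if $\|x+\lambda y\| \geq \|x\|$ for all $\lambda \in \mathbb{R}$. An element $x \in \mathbb{X}$ is a right-symmetric point in $\mathbb{X}$ if for every $y \in \mathbb{X}$, $y \perp_B x$ implies $x \perp_B y$. *)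

theory Defs
  imports "HOL-Analysis.Analysis"
begin

definition birkhoff_james_orthogonal :: "'a::real_normed_vector \<Rightarrow> 'a \<Rightarrow> bool"
    (infix "\<bottom>\<^sub>B" 50) where
  "x \<bottom>\<^sub>B y \<longleftrightarrow> (\<forall>c::real. norm (x + c *\<^sub>R y) \<ge> norm x)"

definition right_symmetric_point :: "'a::real_normed_vector \<Rightarrow> bool" where
  "right_symmetric_point x \<longleftrightarrow> (\<forall>y. y \<bottom>\<^sub>B x \<longrightarrow> x \<bottom>\<^sub>B y)"

definition polyhedral_space :: "'a::real_normed_vector itself \<Rightarrow> bool" where
  "polyhedral_space _ \<longleftrightarrow> finite {x::'a. x extreme_point_of cball 0 1}"

definition regular_polygon_vertex :: "nat \<Rightarrow> nat \<Rightarrow> real^2" where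
  "regular_polygon_vertex m j = vector [cos (2 * pi * real j / real m), sin (2 * pi * real j / real m)]"

definition regular_polygon :: "nat \<Rightarrow> (real^2) set" where
  "regular_polygon m = convex hull (regular_polygon_vertex m ` {0..<m})"

(* The linear bijection T is the isomorphism in "up to an isomorphism": the norm of the space,
   transported to the plane along T, is the norm whose closed unit ball is the regular m-gon.
   The Euclidean norm that the type real^2 carries plays no role. *)
definition unit_sphere_regular_polygon :: "'a::real_normed_vector itself \<Rightarrow> nat \<Rightarrow> bool" where
  "unit_sphere_regular_polygon _ m \<longleftrightarrow>
     (\<exists>T :: 'a \<Rightarrow> real^2. linear T \<and> bij T \<and> T ` cball 0 1 = regular_polygon m)"

end

theory Submission imports Defs begin

text \<open>
  In the plane, the polygon lies in the Euclidean unit disc and its vertices lie on the unit circle.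
  Hence the Euclidean norm is at most the polygonal norm, and both agree on multiples of vertices.
  Since the number of sides is divisible by 4, a quarter turn \<open>J\<close> maps vertices to vertices.

  If \<open>v\<close> is a vertex and \<open>y \<bottom>\<^sub>B v\<close>, then comparing \<open>y\<close> with its component along \<open>J v\<close>, on which
  both norms agree, forces \<open>y\<close> to be a multiple of \<open>J v\<close>, and then \<open>v \<bottom>\<^sub>B y\<close> holds already by
  Pythagoras. Conversely, let \<open>z\<close> be a right-symmetric unit vector and let \<open>v\<close> be a vertex maximising
  \<open>z \<bullet> v\<close>. The functional given by \<open>J z\<close> is maximal on the polygon at \<open>J v\<close> and vanishes at \<open>z\<close>, so
  \<open>J v \<bottom>\<^sub>B z\<close>, whence \<open>z \<bottom>\<^sub>B J v\<close>. Removing the \<open>J v\<close>-component of \<open>z\<close> therefore leaves a vector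
  of norm at least 1, that is \<open>z \<bullet> v \<ge> 1\<close>, and equality in Cauchy-Schwarz gives \<open>z = v\<close>.
\<close>

definition rot90 :: "real^2 \<Rightarrow> real^2" where
  "rot90 z = vector [- z $ 2, z $ 1]"

lemma inner_real2: "z \<bullet> w = z $ 1 * w $ 1 + z $ 2 * w $ 2" for z w :: "real^2"
  by (simp add: inner_vec_def sum_2)

lemma rot90_nth [simp]: "rot90 z $ 1 = - z $ 2" "rot90 z $ 2 = z $ 1"
  by (simp_all add: rot90_def)

lemma inner_rot90_rot90 [simp]: "rot90 z \<bullet> rot90 w = z \<bullet> w"
  by (simp add: inner_real2)

lemma inner_rot90_self [simp]: "z \<bullet> rot90 z = 0" "rot90 z \<bullet> z = 0"
  by (simp_all add: inner_real2)

lemma inner_rot90_left: "rot90 z \<bullet> w = - (z \<bullet> rot90 w)"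
  by (simp add: inner_real2)

lemma rot90_rot90 [simp]: "rot90 (rot90 z) = - z"
  by (simp add: vec_eq_iff forall_2)

lemma rot90_decomposition:
  assumes "norm v = 1"
  shows "z = (z \<bullet> v) *\<^sub>R v + (z \<bullet> rot90 v) *\<^sub>R rot90 v"
proof -
  have "v $ 1 * v $ 1 + v $ 2 * v $ 2 = 1"
    using assms by (simp add: norm_eq_1 inner_real2)
  then show ?thesis
    by (simp add: vec_eq_iff forall_2 inner_real2) algebra
qed

lemma regular_polygon_vertex_norm [simp]: "norm (regular_polygon_vertex m j) = 1"
  by (simp add: norm_eq_1 inner_real2 regular_polygon_vertex_def flip: power2_eq_square)

text \<open>Lets the shifted index of a rotated vertex wrap back below \<open>m\<close>.\<close>

lemma regular_polygon_vertex_mod: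
  "regular_polygon_vertex m (j mod m) = regular_polygon_vertex m j"
proof (cases "m = 0")
  case False
  define q where "q = j div m"
  have "real j = real (j mod m) + real m * real q"
    unfolding q_def by (metis mod_mult_div_eq of_nat_add of_nat_mult)
  then have "2 * pi * real j / real m = 2 * pi * real (j mod m) / real m + 2 * pi * real q"
    using False by (simp add: field_simps)
  moreover have "cos (t + 2 * pi * real q) = cos t" "sin (t + 2 * pi * real q) = sin t" for t
    using sin_cos_eq_iff[of "t + 2 * pi * real q" t]
    by (auto intro!: exI[of _ "int q"])
  ultimately show ?thesis
    by (simp add: regular_polygon_vertex_def)
qed simp

text \<open>Moving on by \<open>n\<close> of the \<open>4 * n\<close> vertices adds exactly
  \<open>pi / 2\<close> to the angle.\<close>

lemma rot90_regular_polygon_vertex: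
  assumes "n \<ge> 1"
  shows "rot90 (regular_polygon_vertex (4 * n) j) = regular_polygon_vertex (4 * n) (j + n)"
proof -
  have "2 * pi * real (j + n) / real (4 * n) = 2 * pi * real j / real (4 * n) + pi / 2"
    using assms by (simp add: field_simps)
  then show ?thesis
    by (simp add: vec_eq_iff forall_2 regular_polygon_vertex_def cos_add sin_add del: of_nat_add of_nat_mult)
qed

lemma extreme_point_of_linear_image:
  assumes "linear f" and "inj f"
  shows "f x extreme_point_of f ` S \<longleftrightarrow> x extreme_point_of S"
  using assms
  by (simp add: extreme_point_of_def open_segment_linear_image inj_image_mem_iff)

text \<open>Strict convexity: a point of an open segment is strictly closer to the centre than one
  of the endpoints.\<close>

lemma extreme_point_of_cball:
  fixes z :: "'b::euclidean_space"
  assumes "norm z = r"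
  shows "z extreme_point_of cball 0 r"
  using assms dist_decreases_open_segment[of z _ _ 0]
  by (fastforce simp: extreme_point_of_def)

text \<open>Isolates the features of the polygon on which the argument rests: finitely many
  Euclidean unit vectors, closed under the quarter turn.\<close>

locale quarter_turn_hull_norm =
  fixes T :: "'a::real_normed_vector \<Rightarrow> real^2" and V :: "(real^2) set"
  assumes linear: "linear T" and bij: "bij T"
    and unit_ball: "T ` cball 0 1 = convex hull V"
    and finite: "finite V" and nonempty: "V \<noteq> {}"
    and norm_V: "v \<in> V \<Longrightarrow> norm v = 1"
    and rot90_V: "v \<in> V \<Longrightarrow> rot90 v \<in> V"
begin

lemma inj_T: "inj T"
  using bij by (rule bij_is_inj)

lemma norm_le_1_iff: "norm x \<le> 1 \<longleftrightarrow> T x \<in> convex hull V"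
  using inj_image_mem_iff[OF inj_T, of x "cball 0 1"] by (simp add: unit_ball)

lemma minus_V: "v \<in> V \<Longrightarrow> - v \<in> V"
  using rot90_V[of "rot90 v"] rot90_V[of v] by simp

text \<open>A half-plane containing \<open>V\<close> contains its hull, the image of the unit ball;
  scaling extends the bound to all \<open>x\<close>.\<close>

lemma inner_le_of_V_le:
  assumes "\<And>v. v \<in> V \<Longrightarrow> w \<bullet> v \<le> M"
  shows "w \<bullet> T x \<le> M * norm x"
proof (cases "x = 0")
  case True
  then show ?thesis by (simp add: linear_0[OF linear])
next
  case False
  have "convex hull V \<subseteq> {z. w \<bullet> z \<le> M}"
    using assms by (intro hull_minimal) (auto simp: convex_halfspace_le)
  moreover have "T (x /\<^sub>R norm x) \<in> convex hull V"
    using False by (simp flip: norm_le_1_iff)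
  ultimately have "w \<bullet> T (x /\<^sub>R norm x) \<le> M" by blast
  then show ?thesis
    using False by (simp add: linear_scale[OF linear] field_simps)
qed

text \<open>Cauchy-Schwarz bounds the functional given by \<open>T x\<close> on \<open>V\<close> by
  \<open>norm (T x)\<close>; evaluate it at \<open>x\<close> itself.\<close>

lemma norm_T_le: "norm (T x) \<le> norm x"
proof -
  have "T x \<bullet> v \<le> norm (T x)" if "v \<in> V" for v
    using norm_cauchy_schwarz[of "T x" v] norm_V[OF that] by simp
  from inner_le_of_V_le[OF this, of x] have "norm (T x) * norm (T x) \<le> norm (T x) * norm x"
    by (simp add: dot_square_norm power2_eq_square)
  then show ?thesis
    by (cases "norm (T x) = 0") (simp_all add: mult_le_cancel_left)
qed

lemma norm_vertex:
  assumes "T u \<in> V"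
  shows "norm u = 1"
  using norm_T_le[of u] norm_V[OF assms] norm_le_1_iff[of u] hull_inc[OF assms, of convex]
  by simp

lemma obtain_preimage: obtains u where "T u = z"
  using bij by (metis bij_pointE)

text \<open>For the converse, a point of \<open>V\<close> is extreme in the Euclidean disc, hence in
  the hull inside it.\<close>

lemma extreme_iff: "x extreme_point_of cball 0 1 \<longleftrightarrow> T x \<in> V"
proof
  assume "x extreme_point_of cball 0 1"
  then have "T x extreme_point_of convex hull V"
    by (metis extreme_point_of_linear_image inj_T linear unit_ball)
  then show "T x \<in> V"
    by (rule extreme_point_of_convex_hull)
next
  assume V: "T x \<in> V"
  have "convex hull V \<subseteq> cball 0 1"
    using norm_V by (intro hull_minimal) auto
  moreover have "T x extreme_point_of cball 0 1"
    using norm_V[OF V] by (simp add: extreme_point_of_cball)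
  ultimately have "T x extreme_point_of convex hull V"
    using hull_inc[OF V, of convex] by (auto simp: extreme_point_of_def)
  then show "x extreme_point_of cball 0 1"
    by (metis extreme_point_of_linear_image inj_T linear unit_ball)
qed

lemma right_symmetric_vertex:
  assumes V: "T x \<in> V"
  shows "right_symmetric_point x"
  unfolding right_symmetric_point_def birkhoff_james_orthogonal_def
proof (intro allI impI)
  fix y c
  assume y: "\<forall>c. norm y \<le> norm (y + c *\<^sub>R x)"
  define v where "v = T x"
  define a where "a = T y \<bullet> v"
  define b where "b = T y \<bullet> rot90 v"
  have v: "norm v = 1" using norm_V V by (simp add: v_def)
  obtain u where u: "T u = rot90 v" by (rule obtain_preimage)
  have Ty: "T y = a *\<^sub>R v + b *\<^sub>R rot90 v"
    unfolding a_def b_def by (rule rot90_decomposition[OF v])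
  \<comment> \<open>The scalar \<open>- a\<close> cancels the \<open>v\<close>-component, leaving a
    multiple of a vertex, whose norm is known.\<close>
  have "T (y + (- a) *\<^sub>R x) = T (b *\<^sub>R u)"
    using Ty by (simp add: linear_add[OF linear] linear_diff[OF linear] linear_scale[OF linear] u flip: v_def)
  then have "y + (- a) *\<^sub>R x = b *\<^sub>R u"
    using inj_T by (rule injD[rotated])
  moreover have "norm u = 1"
    using rot90_V[OF V] u by (intro norm_vertex) (simp add: v_def)
  ultimately have "norm y \<le> \<bar>b\<bar>"
    using y[rule_format, of "- a"] by simp
  then have "norm (T y) \<le> \<bar>b\<bar>"
    using norm_T_le[of y] by simp
  then have "T y \<bullet> T y \<le> b\<^sup>2"
    by (metis dot_square_norm norm_ge_zero power2_abs power_mono)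
  moreover have "T y \<bullet> T y = a\<^sup>2 + b\<^sup>2"
    using v by (simp add: Ty inner_simps power2_eq_square norm_eq_1)
  ultimately have "a = 0" by simp
  \<comment> \<open>With \<open>a = 0\<close>, adding multiples of \<open>T y\<close> does not
    change the component along \<open>v\<close>.\<close>
  then have "T (x + c *\<^sub>R y) \<bullet> v = 1"
    using v Ty by (simp add: linear_add[OF linear] linear_scale[OF linear] inner_simps norm_eq_1 flip: v_def)
  then have "1 \<le> norm (T (x + c *\<^sub>R y))"
    using norm_cauchy_schwarz[of "T (x + c *\<^sub>R y)" v] v by simp
  then show "norm x \<le> norm (x + c *\<^sub>R y)"
    using norm_T_le[of "x + c *\<^sub>R y"] norm_vertex[OF V] by simp
qed

lemma vertex_of_right_symmetric:
  assumes x: "norm x = 1" and sym: "right_symmetric_point x"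
  shows "T x \<in> V"
proof -
  define z where "z = T x"
  define M where "M = Max ((\<lambda>v. z \<bullet> v) ` V)"
  have "M \<in> (\<lambda>v. z \<bullet> v) ` V"
    unfolding M_def using finite nonempty by (intro Max_in) auto
  then obtain v where v: "v \<in> V" "z \<bullet> v = M" by auto
  have M: "z \<bullet> w \<le> M" if "w \<in> V" for w
    unfolding M_def using finite that by (intro Max_ge) auto
  have "z \<noteq> 0"
    using x linear_injective_0[OF linear] inj_T by (auto simp: z_def)
  moreover have "z \<bullet> z \<le> M"
    using inner_le_of_V_le[of z M x] M x by (simp add: z_def)
  ultimately have "M > 0"
    by (metis inner_gt_zero_iff less_le_trans)
  \<comment> \<open>The adjoint of the quarter turn is its negative, which also preserves
    \<open>V\<close>.\<close>
  have rotM: "rot90 z \<bullet> w \<le> M" if "w \<in> V" for w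
    using M[OF minus_V[OF rot90_V[OF that]]] by (simp add: inner_rot90_left)
  obtain y where y: "T y = rot90 v" by (rule obtain_preimage)
  have norm_y: "norm y = 1"
    using y rot90_V v(1) by (simp add: norm_vertex)
  have "y \<bottom>\<^sub>B x"
    unfolding birkhoff_james_orthogonal_def
  proof
    fix c
    \<comment> \<open>The functional vanishes at \<open>z\<close> and takes the value
      \<open>z \<bullet> v\<close> at \<open>rot90 v\<close>.\<close>
    have "M = rot90 z \<bullet> T (y + c *\<^sub>R x)"
      using v(2) by (simp add: linear_add[OF linear] linear_scale[OF linear] y inner_simps flip: z_def)
    also have "\<dots> \<le> M * norm (y + c *\<^sub>R x)"
      by (rule inner_le_of_V_le) (rule rotM)
    finally show "norm y \<le> norm (y + c *\<^sub>R x)"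
      using \<open>M > 0\<close> norm_y by simp
  qed
  then have "x \<bottom>\<^sub>B y"
    using sym by (simp add: right_symmetric_point_def)
  \<comment> \<open>This scalar removes the \<open>rot90 v\<close>-component of \<open>z\<close>, so
    that only \<open>M *\<^sub>R v\<close> remains.\<close>
  then have le: "1 \<le> norm (x + (- (z \<bullet> rot90 v)) *\<^sub>R y)"
    unfolding birkhoff_james_orthogonal_def using x by metis
  obtain u where u: "T u = v" by (rule obtain_preimage)
  have "T (x + (- (z \<bullet> rot90 v)) *\<^sub>R y) = T (M *\<^sub>R u)"
    using rot90_decomposition[OF norm_V[OF v(1)], of z] v(2)
    by (simp add: linear_add[OF linear] linear_diff[OF linear] linear_scale[OF linear] y u algebra_simps flip: z_def)
  then have "x + (- (z \<bullet> rot90 v)) *\<^sub>R y = M *\<^sub>R u"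
    using inj_T by (rule injD[rotated])
  then have "1 \<le> M"
    using le \<open>M > 0\<close> norm_vertex[of u] u v(1) by simp
  moreover have "norm z \<le> 1"
    using norm_T_le[of x] x by (simp add: z_def)
  \<comment> \<open>Expand the square as \<open>(norm z)\<^sup>2 - 2 * M + 1\<close>.\<close>
  ultimately have "(norm (z - v))\<^sup>2 \<le> 0"
    using v norm_V[OF v(1)] power_le_one[of "norm z" 2]
    by (simp add: power2_norm_eq_inner inner_simps inner_commute norm_eq_1)
  then show ?thesis
    using v(1) by (simp add: z_def)
qed

end

theorem theorem2p7:
  fixes n :: nat and x :: "'a::banach"
  assumes "n \<ge> 1"
    and "dim (UNIV :: 'a set) = 2"
    and "polyhedral_space TYPE('a)"
    and "unit_sphere_regular_polygon TYPE('a) (4 * n)"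
    and "x \<in> sphere 0 1"
  shows "right_symmetric_point x \<longleftrightarrow> x extreme_point_of cball 0 1"
proof -
  obtain T :: "'a \<Rightarrow> real^2"
    where T: "linear T" "bij T" "T ` cball 0 1 = regular_polygon (4 * n)"
    using assms(4) unfolding unit_sphere_regular_polygon_def by blast
  define V where "V = regular_polygon_vertex (4 * n) ` {0..<4 * n}"
  interpret quarter_turn_hull_norm T V
  proof (rule quarter_turn_hull_norm.intro)
    show "T ` cball 0 1 = convex hull V"
      using T(3) by (simp add: V_def regular_polygon_def)
    show "rot90 v \<in> V" if v: "v \<in> V" for v
    proof -
      obtain j where "v = regular_polygon_vertex (4 * n) j"
        using v by (auto simp: V_def)
      then have "rot90 v = regular_polygon_vertex (4 * n) ((j + n) mod (4 * n))"
        using assms(1) by (simp add: rot90_regular_polygon_vertex regular_polygon_vertex_mod)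
      then show ?thesis
        using assms(1) by (simp add: V_def)
    qed
  qed (use T assms(1) in \<open>auto simp: V_def\<close>)
  have "norm x = 1" using assms(5) by simp
  then show ?thesis
    using right_symmetric_vertex vertex_of_right_symmetric extreme_iff by blast
qed

end
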